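(* For each positive integer $n$, let $P(n)$ denote the maximum, over all graphs $G$ of order $n$ that are simultaneously 3-degenerate, bipartite and planar, of the number of minimal connected dominating sets of $G$. Then $P(n) \in \Omega(1.472^n)$; that is, there exist a real constant $c>0$ and an integer $n_0$ such that $P(n) \ge c\cdot 1.472^n$ for all $n \ge n_0$.
   Context: Graphs are finite, simple and undirected; the order of a graph is its number of vertices. A connected dominating set in a graph $G=(V,E)$ is a set $S\subseteq V$ whose closed neighborhood is $V$ (every vertex of $G$ is in $S$ or adjacent to a vertex of $S$) and such that the subgraph of $G$ induced by $S$ is connected. A connected dominating set is minimal (inclusion minimal) if it does not contain another connected dominating set as a proper subset. A graph is 3-degenerate if each of its non-empty subgraphs has a vertex of degree at most 3 in that subgraph. *)

theory Defs
  imports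
    "HOL-Analysis.Analysis"
    "HOL-Library.Landau_Symbols"
    "Graph_Theory.Digraph_Component"
begin

text \<open>
  A finite simple undirected graph is a \<^term>\<open>pair_graph\<close>: a finite loop-free symmetric relation
  \<^term>\<open>parcs G\<close> on the vertex set \<^term>\<open>pverts G\<close>. An undirected edge \<open>{u, v}\<close> is represented by
  the two pairs \<open>(u, v)\<close> and \<open>(v, u)\<close>, so the degree of a vertex is its out-degree.
\<close>

subsection \<open>Connected dominating sets\<close>

definition connected_dominating_set :: "'a pair_pre_digraph \<Rightarrow> 'a set \<Rightarrow> bool" where
  "connected_dominating_set G S \<longleftrightarrow>
     S \<subseteq> pverts G \<and>
     (\<forall>v\<in>pverts G. v \<in> S \<or> (\<exists>u\<in>S. (u, v) \<in> parcs G)) \<and>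
     Digraph_Component.connected (with_proj G \<restriction> S)"

definition minimal_connected_dominating_set :: "'a pair_pre_digraph \<Rightarrow> 'a set \<Rightarrow> bool" where
  "minimal_connected_dominating_set G S \<longleftrightarrow>
     connected_dominating_set G S \<and> (\<forall>T. T \<subset> S \<longrightarrow> \<not> connected_dominating_set G T)"

subsection \<open>Graph classes\<close>

definition degenerate :: "nat \<Rightarrow> 'a pair_pre_digraph \<Rightarrow> bool" where
  "degenerate k G \<longleftrightarrow>
     (\<forall>H. pair_graph H \<and> subgraph (with_proj H) (with_proj G) \<and> pverts H \<noteq> {} \<longrightarrow>
        (\<exists>v\<in>pverts H. out_degree (with_proj H) v \<le> k))"

definition bipartite :: "'a pair_pre_digraph \<Rightarrow> bool" where
  "bipartite G \<longleftrightarrow>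
     (\<exists>A B. A \<union> B = pverts G \<and> A \<inter> B = {} \<and> parcs G \<subseteq> A \<times> B \<union> B \<times> A)"

text \<open>
  A plane drawing sends vertices to distinct points and edges to simple arcs of the plane. The
  two orientations of an edge are drawn as the same arc, traversed in opposite directions; an
  edge meets the drawn vertices only in its own ends, and two different edges meet only in
  (the images of) their common ends.
\<close>

definition plane_drawing ::
    "'a pair_pre_digraph \<Rightarrow> ('a \<Rightarrow> complex) \<Rightarrow> ('a \<times> 'a \<Rightarrow> real \<Rightarrow> complex) \<Rightarrow> bool" where
  "plane_drawing G p \<gamma> \<longleftrightarrow>
     inj_on p (pverts G) \<and>
     (\<forall>(u, v)\<in>parcs G.
        arc (\<gamma> (u, v)) \<and> pathstart (\<gamma> (u, v)) = p u \<and> pathfinish (\<gamma> (u, v)) = p v \<and>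
        \<gamma> (v, u) = reversepath (\<gamma> (u, v)) \<and>
        path_image (\<gamma> (u, v)) \<inter> p ` pverts G = {p u, p v}) \<and>
     (\<forall>(u, v)\<in>parcs G. \<forall>(x, y)\<in>parcs G. {u, v} \<noteq> {x, y} \<longrightarrow>
        path_image (\<gamma> (u, v)) \<inter> path_image (\<gamma> (x, y)) \<subseteq> p ` ({u, v} \<inter> {x, y}))"

definition planar :: "'a pair_pre_digraph \<Rightarrow> bool" where
  "planar G \<longleftrightarrow> (\<exists>p \<gamma>. plane_drawing G p \<gamma>)"

subsection \<open>The extremal function\<close>

text \<open>
  All notions above are invariant under isomorphism, so vertices are taken to be natural numbers
  without loss of generality.
\<close>

definition admissible :: "nat \<Rightarrow> nat pair_pre_digraph \<Rightarrow> bool" where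
  "admissible n G \<longleftrightarrow>
     pair_graph G \<and> card (pverts G) = n \<and> degenerate 3 G \<and> bipartite G \<and> planar G"

definition P :: "nat \<Rightarrow> nat" where
  "P n = Max {card {S. minimal_connected_dominating_set G S} | G. admissible n G}"

text \<open>The maximum defining \<^term>\<open>P n\<close> is that of a finite nonempty set, hence attained.\<close>

lemma finite_minimal_connected_dominating_sets:
  assumes "pair_graph G"
  shows "finite {S. minimal_connected_dominating_set G S}"
    and "card {S. minimal_connected_dominating_set G S} \<le> 2 ^ card (pverts G)"
proof -
  have fin: "finite (pverts G)"
    using assms by (simp add: pair_graph_def pair_digraph_def pair_fin_digraph_def
        pair_fin_digraph_axioms_def)
  have sub: "{S. minimal_connected_dominating_set G S} \<subseteq> Pow (pverts G)"
    by (auto simp: minimal_connected_dominating_set_def connected_dominating_set_def)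
  show "finite {S. minimal_connected_dominating_set G S}"
    using finite_subset[OF sub] fin by simp
  show "card {S. minimal_connected_dominating_set G S} \<le> 2 ^ card (pverts G)"
    using card_mono[OF _ sub] fin by (simp add: card_Pow)
qed

lemma P_finite: "finite {card {S. minimal_connected_dominating_set G S} | G. admissible n G}"
proof (rule finite_subset)
  show "{card {S. minimal_connected_dominating_set G S} | G. admissible n G} \<subseteq> {..2 ^ n}"
    using finite_minimal_connected_dominating_sets(2) by (force simp: admissible_def)
qed simp

lemma admissible_edgeless: "admissible n \<lparr>pverts = {..<n}, parcs = {}\<rparr>"
proof -
  let ?G = "\<lparr>pverts = {..<n}, parcs = {}\<rparr> :: nat pair_pre_digraph"
  have "pair_graph ?G"
    by unfold_locales (auto simp: symmetric_def)
  moreover have "degenerate 3 ?G"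
    by (auto simp: degenerate_def subgraph_def out_degree_def out_arcs_def)
  moreover have "bipartite ?G"
    unfolding bipartite_def by (rule exI[of _ "{..<n}"], rule exI[of _ "{}"]) simp
  moreover have "plane_drawing ?G of_nat \<gamma>" for \<gamma>
    by (simp add: plane_drawing_def inj_on_def)
  hence "planar ?G" by (auto simp: planar_def)
  ultimately show ?thesis by (simp add: admissible_def)
qed

lemma P_attained:
  obtains G where "admissible n G" "card {S. minimal_connected_dominating_set G S} = P n"
proof -
  have "P n \<in> {card {S. minimal_connected_dominating_set G S} | G. admissible n G}"
    unfolding P_def using P_finite admissible_edgeless by (intro Max_in) blast+
  with that show thesis by auto
qed

lemma P_upper:
  "admissible n G \<Longrightarrow> card {S. minimal_connected_dominating_set G S} \<le> P n"
  unfolding P_def using P_finite by (intro Max_ge) auto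

end

theory Submission
  imports Defs
begin

text \<open>
  Glue \<open>k\<close> copies of the three-dimensional cube \<open>Q\<^sub>3\<close> at a common vertex, the hub, and attach at
  least one leaf to the hub. A connected dominating set avoiding some leaf contains the hub, and
  then it has at least three further vertices in each cube. Conversely, for a single cube exactly
  15 three-element sets together with the hub form a connected dominating set. Choosing one of them
  in each cube independently therefore gives \<open>15 ^ k\<close> minimal connected dominating sets on
  \<open>7 * k + O(1)\<close> vertices, and \<open>1.472 ^ 7 < 15\<close>. For planarity, draw one cube with straight
  segments inside the cone \<open>0 < y < x\<close> with the hub at the origin; the shears
  \<open>(x, y) \<mapsto> (x, y + i * x)\<close> move the copies into pairwise disjoint cones.
\<close>

section \<open>The cube and its local choices\<close>

text \<open>Labels are read in binary: edges join labels differing in one bit, so the levels at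
  distance 0, 1, 2, 3 from the hub \<open>0\<close> are \<open>{0}\<close>, \<open>{1,2,4}\<close>,
  \<open>{3,5,6}\<close>, \<open>{7}\<close>. Each edge is listed once, with the endpoint nearer to
  the hub first, except that edges inside \<open>cube\<close> run both ways.\<close>

definition cube_edges :: "nat rel" where
  "cube_edges = {(0,1),(0,2),(0,4),(1,3),(1,5),(2,3),(2,6),(4,5),(4,6),(3,7),(5,7),(6,7)}"

definition cube :: "nat rel" where
  "cube = cube_edges \<union> cube_edges\<inverse>"

text \<open>Two families: any two neighbours of the hub with any one vertex of
  \<open>{3,5,6}\<close> (nine sets), and the paths from a neighbour of the hub through
  \<open>{3,5,6}\<close> to \<open>7\<close> (six sets).\<close>

definition local_sets :: "nat set set" where
  "local_sets =
    {{1,2,3},{1,2,5},{1,2,6},{1,4,3},{1,4,5},{1,4,6},{2,4,3},{2,4,5},{2,4,6},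
     {1,3,7},{1,5,7},{2,3,7},{2,6,7},{4,5,7},{4,6,7}}"

lemma card_local_sets: "card local_sets = 15"
  unfolding local_sets_def by code_simp

lemma local_sets_props:
  assumes "J \<in> local_sets"
  shows "J \<subseteq> {1..7}" "card J = 3"
  using assms unfolding local_sets_def by auto

lemma local_sets_connected:
  assumes "J \<in> local_sets" "a \<in> J"
  shows "(0, a) \<in> (cube \<inter> insert 0 J \<times> insert 0 J)\<^sup>*"
proof -
  \<comment> \<open>Three steps suffice from the hub; the third is needed only for \<open>7\<close>
    in the path-shaped sets.\<close>
  have "(0, a) \<in> cube \<or> (\<exists>b\<in>J. (0, b) \<in> cube \<and> (b, a) \<in> cube) \<or>
      (\<exists>b\<in>J. \<exists>c\<in>J. (0, b) \<in> cube \<and> (b, c) \<in> cube \<and> (c, a) \<in> cube)"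
  proof -
    have "\<forall>J\<in>local_sets. \<forall>a\<in>J. (0, a) \<in> cube \<or> (\<exists>b\<in>J. (0, b) \<in> cube \<and> (b, a) \<in> cube) \<or>
        (\<exists>b\<in>J. \<exists>c\<in>J. (0, b) \<in> cube \<and> (b, c) \<in> cube \<and> (c, a) \<in> cube)"
      unfolding local_sets_def cube_def cube_edges_def by simp
    then show ?thesis using assms by blast
  qed
  moreover have "(x, y) \<in> (cube \<inter> insert 0 J \<times> insert 0 J)\<^sup>*"
    if "(x, y) \<in> cube" "x \<in> insert 0 J" "y \<in> insert 0 J" for x y
    using that by blast
  ultimately show ?thesis
    using assms(2) by (meson insertI1 insertI2 rtrancl_trans)
qed

lemma local_sets_dominating:
  assumes "J \<in> local_sets" "a \<in> {1..7}" "a \<notin> J"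
  shows "\<exists>b\<in>insert 0 J. (b, a) \<in> cube"
proof -
  have "\<forall>J\<in>local_sets. \<forall>a\<in>{1,2,3,4,5,6,7}. a \<notin> J \<longrightarrow> (\<exists>b\<in>insert 0 J. (b, a) \<in> cube)"
    unfolding local_sets_def cube_def cube_edges_def by simp
  moreover have "a \<in> {1,2,3,4,5,6,7}" using assms(2) by auto
  ultimately show ?thesis using assms(1,3) by blast
qed

text \<open>Domination of \<open>7\<close> or its connection to the hub forces a vertex of
  \<open>{3,5,6}\<close>, and connection to the hub forces one of \<open>{1,2,4}\<close>; two such
  vertices alone leave something undominated. Connectivity of \<open>insert 0 J\<close> enters
  through cuts avoiding the hub, a form that carries over from a set spread over many cubes to its
  part in one of them.\<close>

lemma card_local_ge_3:
  assumes sub: "J \<subseteq> {1..7}"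
    and dom: "\<And>a. a \<in> {1..7} \<Longrightarrow> a \<notin> J \<Longrightarrow> \<exists>b\<in>insert 0 J. (b, a) \<in> cube"
    and cut: "\<And>X. X \<subseteq> J \<Longrightarrow> X \<noteq> {} \<Longrightarrow> \<exists>a\<in>X. \<exists>b\<in>insert 0 J - X. (a, b) \<in> cube"
  shows "3 \<le> card J"
proof -
  have fin: "finite J" using sub finite_subset by blast
  have mid: "\<exists>m\<in>J. m \<in> {3,5,6}"
  proof (cases "7 \<in> J")
    case True
    with cut[of "{7}"] show ?thesis by (auto simp: cube_def cube_edges_def)
  next
    case False
    with dom[of 7] show ?thesis by (auto simp: cube_def cube_edges_def)
  qed
  then obtain m where m: "m \<in> J" "m \<in> {3,5,6}" by blast
  \<comment> \<open>For the cut \<open>X = J\<close> only the hub remains on the other side.\<close>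
  have "\<exists>b\<in>J. (b, 0) \<in> cube"
    using cut[of J] m(1) by blast
  then obtain b where b: "b \<in> J" "b \<in> {1,2,4}"
    by (auto simp: cube_def cube_edges_def)
  have "J \<noteq> {m, b}"
  proof
    assume J: "J = {m, b}"
    have bm: "(b, m) \<in> cube"
    proof -
      have "(m, 0) \<notin> cube"
        using m(2) by (auto simp: cube_def cube_edges_def)
      then have "(m, b) \<in> cube"
        using cut[of "{m}"] unfolding J by blast
      then show ?thesis by (auto simp: cube_def)
    qed
    have *: "a \<in> {1..7} \<Longrightarrow> a \<notin> {m,b} \<Longrightarrow> (0,a) \<in> cube \<or> (b,a) \<in> cube \<or> (m,a) \<in> cube" for a
      using dom[of a] unfolding J by auto
    \<comment> \<open>The witness is the antipode \<open>7 - b\<close>: the only vertex of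
      \<open>{3,5,6}\<close> not adjacent to \<open>b\<close>, and on the same level as
      \<open>m\<close>.\<close>
    have "\<forall>b\<in>{1,2,4}. \<forall>m\<in>{3,5,6}. (b, m) \<in> cube \<longrightarrow> (\<exists>a\<in>{3,5,6}. a \<notin> {m, b} \<and>
        (0, a) \<notin> cube \<and> (b, a) \<notin> cube \<and> (m, a) \<notin> cube)"
      unfolding cube_def cube_edges_def by simp
    then obtain a where a: "a \<in> {3,5,6}" "a \<notin> {m, b}"
      "(0, a) \<notin> cube" "(b, a) \<notin> cube" "(m, a) \<notin> cube"
      using bm m(2) b(2) by blast
    have "a \<in> {1..7}" using a(1) by auto
    with *[of a] a show False by blast
  qed
  then have "{m, b} \<subset> J" using m(1) b(1) by blast
  moreover have "card {m, b} = 2" using m(2) b(2) by auto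
  ultimately show ?thesis
    using psubset_card_mono[OF fin, of "{m,b}"] by linarith
qed

section \<open>Gluing copies of the cube at the hub\<close>

text \<open>Copy \<open>i\<close> occupies the block \<open>7 * i + 1\<close> to
  \<open>7 * i + 7\<close>, and all copies share \<open>0\<close>, so the blocks tile the natural
  numbers.\<close>

definition glue :: "nat \<Rightarrow> nat \<Rightarrow> nat" where
  "glue i a = (if a = 0 then 0 else 7 * i + a)"

lemma glue_0 [simp]: "glue i 0 = 0"
  by (simp add: glue_def)

lemma glue_eq_0 [simp]: "glue i a = 0 \<longleftrightarrow> a = 0"
  by (auto simp: glue_def)

lemma glue_eq_iff:
  assumes "a \<le> 7" "b \<le> 7"
  shows "glue i a = glue j b \<longleftrightarrow> a = b \<and> (a = 0 \<or> i = j)"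
  using assms unfolding glue_def by (auto; presburger)

lemma glue_cases:
  obtains i a where "a \<le> 7" "v = glue i a"
proof (cases "v = 0")
  case True
  then show ?thesis using that[of 0 0] by simp
next
  case False
  then have "v = glue ((v - 1) div 7) ((v - 1) mod 7 + 1)"
    by (simp add: glue_def)
  moreover have "(v - 1) mod 7 + 1 \<le> 7"
    using mod_less_divisor[of 7 "v - 1"] by linarith
  ultimately show ?thesis using that by blast
qed

lemma cube_le_7: "(a, b) \<in> cube \<Longrightarrow> a \<le> 7 \<and> b \<le> 7"
  by (auto simp: cube_def cube_edges_def)

lemma cube_sym: "(a, b) \<in> cube \<Longrightarrow> (b, a) \<in> cube"
  by (auto simp: cube_def)

text \<open>Infinitely many copies are glued at once; the finite graphs used later are induced
  subgraphs and inherit its planarity, degeneracy and bipartiteness.\<close>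

definition bouquet :: "nat rel" where
  "bouquet = {(glue i a, glue i b) | i a b. (a, b) \<in> cube}"

lemma bouquet_sym: "(u, v) \<in> bouquet \<Longrightarrow> (v, u) \<in> bouquet"
  by (auto simp: bouquet_def intro: cube_sym)

lemma bouquet_irrefl: "(u, u) \<notin> bouquet"
  by (auto simp: bouquet_def glue_def cube_def cube_edges_def)

lemma glue_bouquet: "(a, b) \<in> cube \<Longrightarrow> (glue i a, glue i b) \<in> bouquet"
  by (auto simp: bouquet_def)

text \<open>Distinct copies meet only in the hub, so an edge leaving a non-hub vertex stays in its
  copy.\<close>

lemma bouquet_from_glue:
  assumes "(glue i a, v) \<in> bouquet" "a \<le> 7" "a \<noteq> 0"
  obtains b where "v = glue i b" "(a, b) \<in> cube"
proof -
  obtain j c d where *: "glue i a = glue j c" "v = glue j d" "(c, d) \<in> cube"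
    using assms(1) unfolding bouquet_def by blast
  then have "a = c" "i = j"
    using glue_eq_iff[of a c i j] cube_le_7 assms(2,3) by blast+
  with * that show ?thesis by blast
qed

lemma bouquet_degree:
  assumes "v \<noteq> 0"
  shows "finite (bouquet `` {v})" "card (bouquet `` {v}) \<le> 3"
proof -
  obtain i a where v: "a \<le> 7" "v = glue i a" by (rule glue_cases)
  then have "a \<in> {1,2,3,4,5,6,7}" using assms by auto
  moreover have "\<forall>a\<in>{1,2,3,4,5,6,7}. \<exists>b c d. cube `` {a} \<subseteq> {b, c, d}"
    unfolding cube_def cube_edges_def by (simp add: Image_def) (auto)
  ultimately obtain b c d where sub: "cube `` {a} \<subseteq> {b, c, d}" by blast
  have "bouquet `` {v} \<subseteq> glue i ` (cube `` {a})"
    using v assms by (auto elim!: bouquet_from_glue)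
  also have "\<dots> \<subseteq> {glue i b, glue i c, glue i d}"
    using sub by blast
  finally have *: "bouquet `` {v} \<subseteq> set [glue i b, glue i c, glue i d]"
    by simp
  then show "finite (bouquet `` {v})"
    by (rule finite_subset) simp
  show "card (bouquet `` {v}) \<le> 3"
    using card_mono[OF _ *] card_length[of "[glue i b, glue i c, glue i d]"] by simp
qed

text \<open>The labels \<open>0\<close>, \<open>3\<close>, \<open>5\<close>, \<open>6\<close> have
  an even number of binary ones, and an edge flips one bit. The hub is even in every copy, so the
  colourings of the copies agree.\<close>

lemma parity_cube:
  assumes "(a, b) \<in> cube"
  shows "a \<in> {0,3,5,6} \<longleftrightarrow> b \<notin> {0,3,5,6}"
  using assms by (auto simp: cube_def cube_edges_def)

definition even_part :: "nat set" where
  "even_part = {glue i a | i a. a \<in> {0,3,5,6}}"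

lemma glue_even_part:
  assumes "a \<le> 7"
  shows "glue i a \<in> even_part \<longleftrightarrow> a \<in> {0,3,5,6}"
proof
  assume "glue i a \<in> even_part"
  then obtain j b where b: "glue i a = glue j b" "b \<in> {0,3,5,6}"
    unfolding even_part_def by blast
  then have "b \<le> 7" by auto
  then have "a = b" using b(1) glue_eq_iff[OF assms] by blast
  then show "a \<in> {0,3,5,6}" using b(2) by simp
qed (auto simp: even_part_def)

lemma bouquet_bipartite:
  assumes "(u, v) \<in> bouquet"
  shows "u \<in> even_part \<longleftrightarrow> v \<notin> even_part"
  using assms parity_cube cube_le_7 glue_even_part unfolding bouquet_def by blast

subsection \<open>Planarity, degeneracy and bipartiteness\<close>

text \<open>The face \<open>0, 1, 3, 2\<close> is a quadrilateral enclosing the opposite face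
  \<open>4, 5, 7, 6\<close>. The outer face contains the hub, and every other point satisfies
  \<open>0 < y < x\<close>.\<close>

definition drawing :: "nat \<Rightarrow> complex" where
  "drawing a = (\<lambda>(x, y). Complex x y)
     ([(0,0), (6,1), (6,5), (12,6), (4,2), (6,2), (6,4), (8,4)] ! a)"

definition shear :: "nat \<Rightarrow> complex \<Rightarrow> complex" where
  "shear i z = Complex (Re z) (Im z + real i * Re z)"

lemma Re_shear [simp]: "Re (shear i z) = Re z"
  and Im_shear [simp]: "Im (shear i z) = Im z + real i * Re z"
  by (simp_all add: shear_def)

lemma shear_0 [simp]: "shear i 0 = 0"
  by (simp add: complex_eq_iff)

lemma inj_shear: "inj (shear i)"
  by (auto simp: inj_def complex_eq_iff)

lemma linear_shear: "linear (shear i)"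
  by (auto simp: linear_iff complex_eq_iff algebra_simps)

lemma shear_segment: "closed_segment (shear i z) (shear i w) = shear i ` closed_segment z w"
  by (simp add: closed_segment_linear_image linear_shear)

lemma drawing_simps [simp]:
  "drawing 0 = 0" "drawing 1 = Complex 6 1" "drawing (Suc 0) = Complex 6 1"
  "drawing 2 = Complex 6 5" "drawing 3 = Complex 12 6"
  "drawing 4 = Complex 4 2" "drawing 5 = Complex 6 2" "drawing 6 = Complex 6 4"
  "drawing 7 = Complex 8 4"
  by (simp_all add: drawing_def complex_eq_iff)

definition cone :: "complex set" where
  "cone = insert 0 {z. 0 < Im z \<and> Im z < Re z}"

text \<open>A nonzero point of the cone sheared by \<open>i\<close> has slope strictly between
  \<open>i\<close> and \<open>i + 1\<close>.\<close>

lemma cone_disjoint: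
  assumes "z \<in> shear i ` cone" "z \<in> shear j ` cone" "z \<noteq> 0"
  shows "i = j"
proof -
  have *: "0 < Re z \<and> real i * Re z < Im z \<and> Im z < real (i + 1) * Re z"
    if "z \<in> shear i ` cone" for i
    using that assms(3) by (auto simp: cone_def algebra_simps)
  have "real i * Re z < real (j + 1) * Re z" "real j * Re z < real (i + 1) * Re z" "0 < Re z"
    using *[OF assms(1)] *[OF assms(2)] by linarith+
  then have "real i < real (j + 1)" "real j < real (i + 1)"
    by (simp_all only: mult_less_cancel_right_pos)
  then show ?thesis by simp
qed

lemma segment_coords:
  fixes z :: complex
  assumes "z \<in> closed_segment (Complex a b) (Complex c d)"
  obtains t where "0 \<le> t" "t \<le> 1" "Re z = a + t * (c - a)" "Im z = b + t * (d - b)"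
proof -
  obtain t where t: "0 \<le> t" "t \<le> 1" "z = (1 - t) *\<^sub>R Complex a b + t *\<^sub>R Complex c d"
    using assms by (auto simp: in_segment)
  have "Re z = a + t * (c - a)" "Im z = b + t * (d - b)"
    unfolding t(3) by (simp_all add: algebra_simps)
  with t(1,2) that show ?thesis by blast
qed

text \<open>With \<open>cube_edges\<close> in place of \<open>cube\<close>, different pairs are
  different undirected edges, and an edge at the hub has the hub as its first component.\<close>

definition on_edge :: "nat \<times> nat \<Rightarrow> real \<Rightarrow> real \<Rightarrow> bool" where
  "on_edge e x y \<longleftrightarrow> e \<in> cube_edges \<and>
     Complex x y \<in> closed_segment (drawing (fst e)) (drawing (snd e))"

text \<open>Each segment becomes a line equation with bounds on one coordinate, which leaves the
  crossing questions to linear arithmetic.\<close>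

lemma on_edgeD:
  "on_edge (0,1) x y \<Longrightarrow> x = 6 * y \<and> 0 \<le> y \<and> y \<le> 1"
  "on_edge (0,2) x y \<Longrightarrow> 5 * x = 6 * y \<and> 0 \<le> y \<and> y \<le> 5"
  "on_edge (0,4) x y \<Longrightarrow> x = 2 * y \<and> 0 \<le> y \<and> y \<le> 2"
  "on_edge (1,3) x y \<Longrightarrow> 6 * y = 5 * x - 24 \<and> 1 \<le> y \<and> y \<le> 6"
  "on_edge (1,5) x y \<Longrightarrow> x = 6 \<and> 1 \<le> y \<and> y \<le> 2"
  "on_edge (2,3) x y \<Longrightarrow> x = 6 * y - 24 \<and> 5 \<le> y \<and> y \<le> 6"
  "on_edge (2,6) x y \<Longrightarrow> x = 6 \<and> 4 \<le> y \<and> y \<le> 5"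
  "on_edge (4,5) x y \<Longrightarrow> y = 2 \<and> 4 \<le> x \<and> x \<le> 6"
  "on_edge (4,6) x y \<Longrightarrow> x = y + 2 \<and> 2 \<le> y \<and> y \<le> 4"
  "on_edge (3,7) x y \<Longrightarrow> x = 2 * y \<and> 4 \<le> y \<and> y \<le> 6"
  "on_edge (5,7) x y \<Longrightarrow> x = y + 4 \<and> 2 \<le> y \<and> y \<le> 4"
  "on_edge (6,7) x y \<Longrightarrow> y = 4 \<and> 6 \<le> x \<and> x \<le> 8"
  by (simp_all add: on_edge_def zero_complex.code; elim conjE segment_coords; simp)+

lemma on_edge_cone:
  assumes "on_edge e x y"
  shows "Complex x y \<in> cone" "x = 0 \<Longrightarrow> fst e = 0"
proof -
  have "e \<in> cube_edges" using assms on_edge_def by simp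
  then have "x = 0 \<and> y = 0 \<and> fst e = 0 \<or> 0 < y \<and> y < x"
    using assms unfolding cube_edges_def
    by (elim insertE emptyE; hypsubst) (drule on_edgeD, force)+
  then show "Complex x y \<in> cone" "x = 0 \<Longrightarrow> fst e = 0"
    by (auto simp: cone_def complex_eq_iff)
qed

text \<open>A finite check over pairs of edges: the linear conditions of two different edges are
  either contradictory or determine the common endpoint.\<close>

lemma on_edge_inter:
  assumes "on_edge e x y" "on_edge e' x y" "e \<noteq> e'"
  shows "\<exists>c \<in> {fst e, snd e} \<inter> {fst e', snd e'}. Complex x y = drawing c"
proof -
  have "e \<in> cube_edges" "e' \<in> cube_edges" using assms on_edge_def by simp_all
  then show ?thesis
    using assms unfolding cube_edges_def
    apply -
    apply (elim insertE emptyE; hypsubst)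
    apply (simp_all only: not_False_eq_True fst_conv snd_conv)
    apply (drule on_edgeD, drule on_edgeD, simp add: complex_eq_iff zero_complex.code; linarith?)+
    done
qed

section \<open>A plane drawing of the bouquet\<close>

text \<open>For \<open>v > 0\<close>, division of \<open>v - 1\<close> by 7 inverts
  \<open>glue\<close>: the quotient is the copy, the remainder plus one is the label.\<close>

definition position :: "nat \<Rightarrow> complex" where
  "position v = (if v = 0 then 0 else shear ((v - 1) div 7) (drawing ((v - 1) mod 7 + 1)))"

lemma position_glue:
  assumes "a \<le> 7"
  shows "position (glue i a) = shear i (drawing a)"
proof (cases a)
  case (Suc c)
  then have "c < 7" using assms by simp
  moreover have "glue i a - 1 = 7 * i + c" by (simp add: glue_def Suc)
  ultimately have "(glue i a - 1) div 7 = i" "(glue i a - 1) mod 7 + 1 = a"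
    using Suc by simp_all
  then show ?thesis using Suc by (simp add: position_def)
qed (simp add: position_def)

lemma drawing_cone:
  assumes "a \<le> 7"
  shows "drawing a \<in> cone" "drawing a = 0 \<Longrightarrow> a = 0"
proof -
  have "a \<in> {0,1,2,3,4,5,6,7}" using assms by auto
  then show "drawing a \<in> cone" "drawing a = 0 \<Longrightarrow> a = 0"
    by (auto simp: cone_def complex_eq_iff)
qed

lemma inj_on_drawing: "inj_on drawing {..7}"
proof -
  have "{..7} = {0,1,2,3,4,5,6,7::nat}" by auto
  then show ?thesis by (simp add: complex_eq_iff)
qed

lemma inj_position: "inj position"
proof (rule injI)
  fix u v
  assume eq: "position u = position v"
  obtain i a where u: "a \<le> 7" "u = glue i a" by (rule glue_cases)
  obtain j b where v: "b \<le> 7" "v = glue j b" by (rule glue_cases)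
  have eq': "shear i (drawing a) = shear j (drawing b)"
    using eq u v by (simp add: position_glue)
  have zero: "shear l z = 0 \<longleftrightarrow> z = 0" for l z
    using inj_eq[OF inj_shear, of l z 0] by simp
  show "u = v"
  proof (cases "drawing a = 0")
    case True
    then have "drawing b = 0" using eq' zero by metis
    then have "a = 0" "b = 0" using True u(1) v(1) drawing_cone(2) by blast+
    then show ?thesis using u v by simp
  next
    case False
    then have "shear i (drawing a) \<noteq> 0" using zero by blast
    moreover have "shear i (drawing a) \<in> shear i ` cone" "shear i (drawing a) \<in> shear j ` cone"
      using eq' drawing_cone(1)[OF u(1)] drawing_cone(1)[OF v(1)] by (metis imageI)+
    ultimately have "i = j" using cone_disjoint by blast
    then have "drawing a = drawing b" using eq' inj_eq[OF inj_shear] by metis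
    then have "a = b" using inj_on_drawing u v by (auto dest: inj_onD)
    then show ?thesis using u v \<open>i = j\<close> by simp
  qed
qed

text \<open>A point of a drawn edge is pulled back to the unsheared cube. The endpoints are only
  recovered as a set because the edge may have to be reversed to lie in
  \<open>cube_edges\<close>.\<close>

lemma bouquet_segment:
  assumes "(u, v) \<in> bouquet" "z \<in> closed_segment (position u) (position v)"
  obtains i a b x y where "{u, v} = {glue i a, glue i b}" "a \<le> 7" "b \<le> 7"
    "on_edge (a, b) x y" "z = shear i (Complex x y)"
proof -
  obtain i a b where e: "u = glue i a" "v = glue i b" "(a, b) \<in> cube"
    using assms(1) unfolding bouquet_def by blast
  have le: "a \<le> 7" "b \<le> 7" using cube_le_7 e(3) by blast+
  have "z \<in> shear i ` closed_segment (drawing a) (drawing b)"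
    using assms(2) e le by (simp add: position_glue shear_segment)
  then obtain w where w: "w \<in> closed_segment (drawing a) (drawing b)" "z = shear i w" by blast
  have w': "w = Complex (Re w) (Im w)" by simp
  consider "(a, b) \<in> cube_edges" | "(b, a) \<in> cube_edges" using e(3) by (auto simp: cube_def)
  then show ?thesis
  proof cases
    case 1
    then have "on_edge (a, b) (Re w) (Im w)" using w(1) by (simp add: on_edge_def)
    then show ?thesis using that[of i a b "Re w" "Im w"] e le w(2) w' by simp
  next
    case 2
    then have "on_edge (b, a) (Re w) (Im w)"
      using w(1) by (simp add: on_edge_def closed_segment_commute)
    then show ?thesis using that[of i b a "Re w" "Im w"] e le w(2) w' by auto
  qed
qed

text \<open>A common point other than the origin lies in one cone only, so both edges belong to the
  same copy and the check for a single cube applies.\<close>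

lemma bouquet_segments_inter:
  assumes "(u, v) \<in> bouquet" "(x, y) \<in> bouquet" "{u, v} \<noteq> {x, y}"
  shows "closed_segment (position u) (position v) \<inter> closed_segment (position x) (position y)
    \<subseteq> position ` ({u, v} \<inter> {x, y})"
proof
  fix z
  assume "z \<in> closed_segment (position u) (position v) \<inter> closed_segment (position x) (position y)"
  then have z: "z \<in> closed_segment (position u) (position v)"
    "z \<in> closed_segment (position x) (position y)" by auto
  obtain i a b r s where 1: "{u, v} = {glue i a, glue i b}" "a \<le> 7" "b \<le> 7"
    "on_edge (a, b) r s" "z = shear i (Complex r s)"
    using bouquet_segment[OF assms(1) z(1)] .
  obtain j c d r' s' where 2: "{x, y} = {glue j c, glue j d}" "c \<le> 7" "d \<le> 7"
    "on_edge (c, d) r' s'" "z = shear j (Complex r' s')"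
    using bouquet_segment[OF assms(2) z(2)] .
  show "z \<in> position ` ({u, v} \<inter> {x, y})"
  proof (cases "z = 0")
    case True
    then have "r = 0" "r' = 0" using 1(5) 2(5) by (simp_all add: complex_eq_iff)
    \<comment> \<open>Within a cube, only edges at the hub reach the origin.\<close>
    then have "a = 0" "c = 0" using on_edge_cone(2) 1(4) 2(4) by fastforce+
    then have "0 \<in> {u, v} \<inter> {x, y}" using 1(1) 2(1) by simp
    moreover have "position 0 = z" using True by (simp add: position_def)
    ultimately show ?thesis by blast
  next
    case False
    then have ij: "i = j"
      using cone_disjoint[of z i j] 1(5) 2(5) on_edge_cone(1)[OF 1(4)] on_edge_cone(1)[OF 2(4)]
      by blast
    then have "r = r'" "s = s'"
      using inj_eq[OF inj_shear, of i "Complex r s" "Complex r' s'"] 1(5) 2(5) by auto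
    moreover have "(a, b) \<noteq> (c, d)" using assms(3) 1(1) 2(1) ij by auto
    ultimately obtain k where k: "k \<in> {a, b} \<inter> {c, d}" "Complex r s = drawing k"
      using on_edge_inter[OF 1(4), of "(c, d)"] 2(4) by auto
    have "k \<le> 7" using k(1) 1(2,3) by auto
    then have "z = position (glue i k)" using k(2) 1(5) by (simp add: position_glue)
    moreover have "glue i k \<in> {u, v} \<inter> {x, y}"
      using k(1) 1(1) 2(1) ij by auto
    ultimately show ?thesis by blast
  qed
qed

lemma bouquet_no_isolated: "\<exists>v. (u, v) \<in> bouquet"
proof -
  obtain i a where u: "a \<le> 7" "u = glue i a" by (rule glue_cases)
  have "a \<in> {0,1,2,3,4,5,6,7}" using u(1) by auto
  moreover have "\<forall>a\<in>{0,1,2,3,4,5,6,7}. a \<in> Domain cube"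
    unfolding cube_def cube_edges_def by simp
  ultimately have "a \<in> Domain cube" by blast
  then show ?thesis using glue_bouquet u(2) by blast
qed

text \<open>Since \<open>w\<close> is an end of some edge, a drawn edge through
  \<open>position w\<close> meets that edge there, and the statement about two edges applies; no
  separate vertex-edge check is made.\<close>

lemma bouquet_segment_vertex:
  assumes "(u, v) \<in> bouquet" "position w \<in> closed_segment (position u) (position v)"
  shows "w \<in> {u, v}"
proof -
  obtain x where x: "(w, x) \<in> bouquet" using bouquet_no_isolated by blast
  show ?thesis
  proof (cases "{u, v} = {w, x}")
    case False
    then have "position w \<in> position ` ({u, v} \<inter> {w, x})"
      using bouquet_segments_inter[OF assms(1) x] assms(2) by auto
    then show ?thesis using inj_image_mem_iff[OF inj_position] by blast
  qed blast
qed

lemma planar_subbouquet: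
  assumes "parcs G \<subseteq> bouquet" "\<And>u v. (u, v) \<in> parcs G \<Longrightarrow> u \<in> pverts G \<and> v \<in> pverts G"
  shows "planar G"
proof -
  define \<gamma> where "\<gamma> = (\<lambda>(u, v). linepath (position u) (position v))"
  have ne: "position u \<noteq> position v" if "(u, v) \<in> parcs G" for u v
  proof -
    have "u \<noteq> v" using that assms(1) bouquet_irrefl[of u] by auto
    then show ?thesis by (simp add: inj_eq[OF inj_position])
  qed
  have image: "path_image (\<gamma> (u, v)) \<inter> position ` pverts G = {position u, position v}"
    if e: "(u, v) \<in> parcs G" for u v
  proof
    show "path_image (\<gamma> (u, v)) \<inter> position ` pverts G \<subseteq> {position u, position v}"
      using bouquet_segment_vertex[of u v] assms(1) e by (auto simp: \<gamma>_def)
    show "{position u, position v} \<subseteq> path_image (\<gamma> (u, v)) \<inter> position ` pverts G"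
      using assms(2)[OF e] by (auto simp: \<gamma>_def)
  qed
  have inter: "path_image (\<gamma> (u, v)) \<inter> path_image (\<gamma> (x, y)) \<subseteq> position ` ({u, v} \<inter> {x, y})"
    if "(u, v) \<in> parcs G" "(x, y) \<in> parcs G" "{u, v} \<noteq> {x, y}" for u v x y
    using bouquet_segments_inter[of u v x y] that assms(1) by (auto simp: \<gamma>_def)
  have "plane_drawing G position \<gamma>"
    unfolding plane_drawing_def
  proof (intro conjI)
    show "inj_on position (pverts G)"
      using inj_position by (rule inj_on_subset) simp
    show "\<forall>(u, v)\<in>parcs G. arc (\<gamma> (u, v)) \<and> pathstart (\<gamma> (u, v)) = position u \<and>
        pathfinish (\<gamma> (u, v)) = position v \<and> \<gamma> (v, u) = reversepath (\<gamma> (u, v)) \<and>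
        path_image (\<gamma> (u, v)) \<inter> position ` pverts G = {position u, position v}"
      by (clarify, intro conjI image) (auto simp: \<gamma>_def ne arc_linepath)
    show "\<forall>(u, v)\<in>parcs G. \<forall>(x, y)\<in>parcs G. {u, v} \<noteq> {x, y} \<longrightarrow>
        path_image (\<gamma> (u, v)) \<inter> path_image (\<gamma> (x, y)) \<subseteq> position ` ({u, v} \<inter> {x, y})"
      using inter by blast
  qed
  then show ?thesis unfolding planar_def by blast
qed

section \<open>Degeneracy and bipartiteness\<close>

text \<open>Only the hub can have degree above 3, so any other vertex of the subgraph serves; a
  subgraph consisting of the hub alone has no arcs.\<close>

lemma degenerate_subbouquet:
  assumes "parcs G \<subseteq> bouquet"
  shows "degenerate 3 G"
  unfolding degenerate_def
proof (intro allI impI)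
  fix H :: "nat pair_pre_digraph"
  assume H: "pair_graph H \<and> subgraph (with_proj H) (with_proj G) \<and> pverts H \<noteq> {}"
  have wf: "v \<in> pverts H" if "(u, v) \<in> parcs H" for u v
  proof -
    interpret pair_graph H using H by simp
    show ?thesis using in_arcsD2 that .
  qed
  have sub: "parcs H \<subseteq> bouquet" using H assms by (auto simp: subgraph_def)
  have deg: "out_degree (with_proj H) v = card (parcs H `` {v})" for v
  proof -
    have "out_arcs (with_proj H) v = Pair v ` (parcs H `` {v})"
      by (auto simp: out_arcs_def)
    then show ?thesis unfolding out_degree_def by (simp add: card_image inj_on_def)
  qed
  show "\<exists>v\<in>pverts H. out_degree (with_proj H) v \<le> 3"
  proof (cases "pverts H = {0}")
    case True
    have "(0, v) \<notin> parcs H" for v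
      using wf[of 0 v] True sub bouquet_irrefl[of 0] by auto
    then have "parcs H `` {0} = {}" by blast
    then show ?thesis using True deg by simp
  next
    case False
    then obtain v where v: "v \<in> pverts H" "v \<noteq> 0"
      using H by (metis is_singletonI' is_singleton_the_elem singleton_iff)
    have "card (parcs H `` {v}) \<le> card (bouquet `` {v})"
      by (rule card_mono[OF bouquet_degree(1)[OF v(2)] Image_mono[OF sub order.refl]])
    also have "\<dots> \<le> 3" by (rule bouquet_degree(2)[OF v(2)])
    finally show ?thesis using v(1) deg by auto
  qed
qed

lemma bipartite_subbouquet:
  assumes "parcs G \<subseteq> bouquet" "\<And>u v. (u, v) \<in> parcs G \<Longrightarrow> u \<in> pverts G \<and> v \<in> pverts G"
  shows "bipartite G"
  unfolding bipartite_def
proof (intro exI conjI)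
  show "pverts G \<inter> even_part \<union> (pverts G - even_part) = pverts G" by blast
  show "pverts G \<inter> even_part \<inter> (pverts G - even_part) = {}" by blast
  show "parcs G \<subseteq> (pverts G \<inter> even_part) \<times> (pverts G - even_part) \<union>
      (pverts G - even_part) \<times> (pverts G \<inter> even_part)"
  proof (rule subrelI)
    fix u v
    assume e: "(u, v) \<in> parcs G"
    then have "u \<in> even_part \<longleftrightarrow> v \<notin> even_part" using assms(1) bouquet_bipartite by blast
    then show "(u, v) \<in> (pverts G \<inter> even_part) \<times> (pverts G - even_part) \<union>
        (pverts G - even_part) \<times> (pverts G \<inter> even_part)"
      using assms(2)[OF e] by blast
  qed
qed

subsection \<open>Connected dominating sets of the bouquet\<close>

lemma connected_inducedI:
  assumes sym: "\<And>u v. (u, v) \<in> parcs G \<Longrightarrow> (v, u) \<in> parcs G"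
    and r: "r \<in> S" and reach: "\<And>v. v \<in> S \<Longrightarrow> (r, v) \<in> (parcs G \<inter> S \<times> S)\<^sup>*"
  shows "Digraph_Component.connected (with_proj G \<restriction> S)"
proof -
  let ?A = "(arcs_ends (with_proj G \<restriction> S))\<^sup>s"
  have A: "?A = parcs G \<inter> S \<times> S"
    using sym by (auto simp: symcl_def arcs_ends_conv)
  have 1: "(r, v) \<in> rtrancl_on S ?A" if "v \<in> S" for v
    using reach[OF that]
    by (induction rule: rtrancl_induct) (auto simp: A r intro: rtrancl_on_into_rtrancl_on)
  have "sym ?A" unfolding A using sym by (auto intro: symI)
  then have 2: "(v, r) \<in> rtrancl_on S ?A" if "v \<in> S" for v
    using symD[OF rtrancl_on_sym 1[OF that]] by blast
  have "(u, v) \<in> rtrancl_on S ?A" if "u \<in> S" "v \<in> S" for u v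
    using rtrancl_on_trans[OF 2[OF that(1)] 1[OF that(2)]] .
  then show ?thesis unfolding connected_conv using r by auto
qed

text \<open>If no edge left \<open>X\<close> within \<open>S\<close>, then \<open>X\<close> would be
  closed under reachability in the induced subgraph and hence be all of \<open>S\<close>.\<close>

lemma connected_induced_cut:
  assumes sym: "\<And>u v. (u, v) \<in> parcs G \<Longrightarrow> (v, u) \<in> parcs G"
    and conn: "Digraph_Component.connected (with_proj G \<restriction> S)"
    and X: "X \<subseteq> S" "X \<noteq> {}" "X \<noteq> S"
  obtains u v where "u \<in> X" "v \<in> S - X" "(u, v) \<in> parcs G"
proof (rule ccontr)
  assume "\<not> thesis"
  with that have no: "\<And>u v. u \<in> X \<Longrightarrow> v \<in> S - X \<Longrightarrow> (u, v) \<notin> parcs G" by blast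
  let ?A = "(arcs_ends (with_proj G \<restriction> S))\<^sup>s"
  have A: "?A = parcs G \<inter> S \<times> S"
    using sym by (auto simp: symcl_def arcs_ends_conv)
  obtain x y where xy: "x \<in> X" "y \<in> S - X" using X by blast
  then have "(x, y) \<in> rtrancl_on S ?A"
    using conn X(1) unfolding connected_conv by auto
  then have "y \<in> X"
    by (induction rule: rtrancl_on_induct) (use xy no A in auto)
  with xy show False by blast
qed

text \<open>The extra vertices \<open>glue i 1\<close> with \<open>k \<le> i < k + r\<close> are leaves at the hub \<open>0\<close>: they force
  the hub into connected dominating sets and pad the order to \<open>7 * k + r + 1\<close>.\<close>

definition bouquet_verts :: "nat \<Rightarrow> nat \<Rightarrow> nat set" where
  "bouquet_verts k r = {..7 * k} \<union> (\<lambda>i. glue i 1) ` {k..<k + r}"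

definition bouquet_graph :: "nat \<Rightarrow> nat \<Rightarrow> nat pair_pre_digraph" where
  "bouquet_graph k r = \<lparr>pverts = bouquet_verts k r,
     parcs = bouquet \<inter> bouquet_verts k r \<times> bouquet_verts k r\<rparr>"

lemma bouquet_graph_simps [simp]:
  "pverts (bouquet_graph k r) = bouquet_verts k r"
  "(u, v) \<in> parcs (bouquet_graph k r) \<longleftrightarrow>
     (u, v) \<in> bouquet \<and> u \<in> bouquet_verts k r \<and> v \<in> bouquet_verts k r"
  by (auto simp: bouquet_graph_def)

lemma finite_bouquet_verts: "finite (bouquet_verts k r)"
  by (simp add: bouquet_verts_def)

lemma card_bouquet_verts: "card (bouquet_verts k r) = 7 * k + r + 1"
proof -
  have "inj_on (\<lambda>i. glue i 1) {k..<k + r}" by (auto simp: inj_on_def glue_def)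
  then have "card ((\<lambda>i. glue i 1) ` {k..<k + r}) = r" by (simp add: card_image)
  moreover have "{..7 * k} \<inter> (\<lambda>i. glue i 1) ` {k..<k + r} = {}" by (auto simp: glue_def)
  ultimately show ?thesis
    unfolding bouquet_verts_def by (subst card_Un_disjoint) auto
qed

lemma zero_in_bouquet_verts [simp]: "0 \<in> bouquet_verts k r"
  by (simp add: bouquet_verts_def)

lemma glue_in_bouquet_verts: "i < k \<Longrightarrow> a \<le> 7 \<Longrightarrow> glue i a \<in> bouquet_verts k r"
  by (auto simp: bouquet_verts_def glue_def)

lemma bouquet_verts_cases:
  assumes "v \<in> bouquet_verts k r"
  obtains "v = 0" | i a where "i < k" "a \<in> {1..7}" "v = glue i a"
    | i where "k \<le> i" "i < k + r" "v = glue i 1"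
proof (cases "v \<in> (\<lambda>i. glue i 1) ` {k..<k + r}")
  case True
  then show ?thesis using that(3) by auto
next
  case False
  then have le: "v \<le> 7 * k" using assms by (auto simp: bouquet_verts_def)
  obtain i a where v: "a \<le> 7" "v = glue i a" by (rule glue_cases)
  show ?thesis
  proof (cases "a = 0")
    case True
    then show ?thesis using that(1) v by simp
  next
    case False
    then have "i < k" using le v by (simp add: glue_def)
    then show ?thesis using that(2)[of i a] v False by simp
  qed
qed

lemma pair_graph_bouquet: "pair_graph (bouquet_graph k r)"
proof
  show "finite (parcs (bouquet_graph k r))"
    by (simp add: bouquet_graph_def finite_bouquet_verts)
  show "symmetric (with_proj (bouquet_graph k r))"
    unfolding symmetric_def using bouquet_sym by (auto intro!: symI)
qed (use bouquet_irrefl in \<open>auto simp: finite_bouquet_verts\<close>)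

section \<open>Choice sets and their minimality\<close>

definition choice_set :: "nat \<Rightarrow> (nat \<Rightarrow> nat set) \<Rightarrow> nat set" where
  "choice_set k f = insert 0 (\<Union>i<k. glue i ` f i)"

text \<open>The choice made in each copy can be read off from the union; both injectivity of the
  construction and minimality rest on this.\<close>

lemma glue_in_choice_set:
  assumes "i < k" "a \<in> {1..7}" "\<And>j. j < k \<Longrightarrow> f j \<subseteq> {1..7}"
  shows "glue i a \<in> choice_set k f \<longleftrightarrow> a \<in> f i"
proof
  assume "glue i a \<in> choice_set k f"
  then obtain j b where "j < k" "b \<in> f j" "glue i a = glue j b"
    using assms(2) by (auto simp: choice_set_def)
  moreover have "b \<le> 7" using assms(3) calculation by fastforce
  ultimately show "a \<in> f i" using glue_eq_iff[of a b i j] assms(2) by auto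
qed (use assms(1) in \<open>auto simp: choice_set_def\<close>)

lemma connected_dominating_choice_set:
  assumes f: "\<And>i. i < k \<Longrightarrow> f i \<in> local_sets"
  shows "connected_dominating_set (bouquet_graph k r) (choice_set k f)"
proof -
  let ?G = "bouquet_graph k r" and ?S = "choice_set k f"
  have sub7: "f i \<subseteq> {1..7}" if "i < k" for i
    using local_sets_props(1) f that by blast
  have sub: "?S \<subseteq> pverts ?G"
    using sub7 glue_in_bouquet_verts by (fastforce simp: choice_set_def)
  have glue_in: "glue i b \<in> ?S" if "i < k" "b \<in> insert 0 (f i)" for i b
    using that by (auto simp: choice_set_def)
  have dom: "v \<in> ?S \<or> (\<exists>u\<in>?S. (u, v) \<in> parcs ?G)" if v: "v \<in> pverts ?G" for v
  proof -
    from v have v': "v \<in> bouquet_verts k r" by simp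
    then show ?thesis
    proof (cases rule: bouquet_verts_cases)
      case 1
      then show ?thesis by (simp add: choice_set_def)
    next
      case (2 i a)
      show ?thesis
      proof (cases "a \<in> f i")
        case True
        then show ?thesis using glue_in 2 by blast
      next
        case False
        then obtain b where "b \<in> insert 0 (f i)" "(b, a) \<in> cube"
          using local_sets_dominating[OF f] 2 by blast
        then have "(glue i b, v) \<in> bouquet" "glue i b \<in> ?S"
          using glue_bouquet glue_in 2 by blast+
        then show ?thesis using sub v by auto
      qed
    next
      case (3 i)
      have "(glue i 0, glue i 1) \<in> bouquet"
        by (rule glue_bouquet) (simp add: cube_def cube_edges_def)
      then show ?thesis using 3 v' by (auto simp: choice_set_def)
    qed
  qed
  have "(0, v) \<in> (parcs ?G \<inter> ?S \<times> ?S)\<^sup>*" if vS: "v \<in> ?S" for v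
  proof (cases "v = 0")
    case False
    then obtain i a where v: "i < k" "a \<in> f i" "v = glue i a"
      using vS unfolding choice_set_def by blast
    \<comment> \<open>A path from the hub inside the local set is carried into copy \<open>i\<close>
      by \<open>glue i\<close>.\<close>
    have "(glue i 0, glue i a) \<in> (parcs ?G \<inter> ?S \<times> ?S)\<^sup>*"
      using local_sets_connected[OF f[OF v(1)] v(2)]
    proof (induction rule: rtrancl_induct)
      case (step y z)
      then have "(glue i y, glue i z) \<in> parcs ?G \<inter> ?S \<times> ?S"
        using glue_bouquet[of y z i] glue_in[OF v(1)] sub by auto
      with step.IH show ?case by (rule rtrancl_into_rtrancl)
    qed simp
    then show ?thesis using v by simp
  qed simp
  then have "Digraph_Component.connected (with_proj ?G \<restriction> ?S)"
    by (intro connected_inducedI[of _ 0]) (auto simp: choice_set_def intro: bouquet_sym)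
  then show ?thesis
    unfolding connected_dominating_set_def using sub dom by blast
qed

text \<open>Once the hub is in \<open>T\<close>, the trace of \<open>T\<close> on a copy satisfies
  the domination and cut conditions for a single cube, because every other vertex of the copy has
  all its neighbours there.\<close>

lemma card_local_part_ge_3:
  assumes T: "connected_dominating_set (bouquet_graph k r) T" "0 \<in> T" and i: "i < k"
  shows "3 \<le> card {a \<in> {1..7}. glue i a \<in> T}" (is "_ \<le> card ?J")
proof (rule card_local_ge_3)
  have T': "T \<subseteq> bouquet_verts k r"
    "\<And>v. v \<in> bouquet_verts k r \<Longrightarrow> v \<notin> T \<Longrightarrow> \<exists>u\<in>T. (u, v) \<in> bouquet"
    "Digraph_Component.connected (with_proj (bouquet_graph k r) \<restriction> T)"
    using T(1) unfolding connected_dominating_set_def by auto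
  have lift: "b \<in> insert 0 ?J" if "(a, b) \<in> cube" "glue i b \<in> T" for a b
    using cube_le_7[OF that(1)] that(2) by auto
  show "?J \<subseteq> {1..7}" by blast
  show "\<exists>b\<in>insert 0 ?J. (b, a) \<in> cube" if a: "a \<in> {1..7}" "a \<notin> ?J" for a
  proof -
    have "glue i a \<in> bouquet_verts k r" using a i by (auto intro: glue_in_bouquet_verts)
    then obtain u where u: "u \<in> T" "(u, glue i a) \<in> bouquet" using T'(2) a by blast
    obtain b where "u = glue i b" "(a, b) \<in> cube"
      using bouquet_from_glue[OF bouquet_sym[OF u(2)]] a(1) by auto
    then show ?thesis using lift u(1) cube_sym by blast
  qed
  show "\<exists>a\<in>X. \<exists>b\<in>insert 0 ?J - X. (a, b) \<in> cube" if X: "X \<subseteq> ?J" "X \<noteq> {}" for X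
  proof -
    have "glue i ` X \<subseteq> T" "glue i ` X \<noteq> {}" using X by auto
    \<comment> \<open>The hub lies in \<open>T\<close> but not in the image of \<open>X\<close>, so
      the cut is proper; its crossing edge starts off the hub and so stays in copy
      \<open>i\<close>.\<close>
    moreover have "glue i ` X \<noteq> T"
    proof -
      have "0 \<notin> glue i ` X" using X(1) by (auto simp: image_iff)
      then show ?thesis using T(2) by blast
    qed
    ultimately obtain u v where uv: "u \<in> glue i ` X" "v \<in> T - glue i ` X"
      "(u, v) \<in> parcs (bouquet_graph k r)"
      using connected_induced_cut[OF _ T'(3)] bouquet_sym bouquet_graph_simps(2) by metis
    then obtain a where a: "a \<in> X" "u = glue i a" by blast
    then have "a \<le> 7" "a \<noteq> 0" using X(1) by auto
    then obtain b where "v = glue i b" "(a, b) \<in> cube"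
      using bouquet_from_glue[of i a v] uv(3) a(2) by auto
    then show ?thesis using a(1) uv(2) lift by blast
  qed
qed

text \<open>A leaf outside the set forces the hub into every connected dominating subset
  \<open>T\<close>. Then \<open>T\<close> has at least three vertices in each copy, which is all
  that the choice set offers there.\<close>

lemma minimal_choice_set:
  assumes f: "\<And>i. i < k \<Longrightarrow> f i \<in> local_sets" and r: "0 < r"
  shows "minimal_connected_dominating_set (bouquet_graph k r) (choice_set k f)"
  unfolding minimal_connected_dominating_set_def
proof (intro conjI allI impI notI)
  show "connected_dominating_set (bouquet_graph k r) (choice_set k f)"
    using f by (rule connected_dominating_choice_set)
next
  fix T
  assume sub: "T \<subset> choice_set k f" and T: "connected_dominating_set (bouquet_graph k r) T"
  have sub7: "f i \<subseteq> {1..7}" if "i < k" for i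
    using local_sets_props(1) f that by blast
  have leaf: "glue k 1 \<notin> choice_set k f"
  proof
    assume "glue k 1 \<in> choice_set k f"
    then obtain j b where "j < k" "b \<in> f j" "glue k 1 = glue j b"
      by (auto simp: choice_set_def)
    moreover have "b \<le> 7" using sub7 calculation by fastforce
    ultimately show False using glue_eq_iff[of 1 b k j] by simp
  qed
  have "glue k 1 \<in> bouquet_verts k r" using r by (auto simp: bouquet_verts_def)
  moreover have "glue k 1 \<notin> T" using leaf sub by blast
  ultimately obtain u where u: "u \<in> T" "(u, glue k 1) \<in> parcs (bouquet_graph k r)"
    using T unfolding connected_dominating_set_def bouquet_graph_simps(1) by blast
  then have "(u, glue k 1) \<in> bouquet" by simp
  then obtain b where b: "u = glue k b" "(1, b) \<in> cube"
    using bouquet_from_glue[OF bouquet_sym, of u k 1] by auto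
  \<comment> \<open>A vertex of the choice set other than the hub lies in a copy with index below
    \<open>k\<close>, while \<open>u\<close> is the hub or lies in copy \<open>k\<close>.\<close>
  have "b = 0"
  proof (rule ccontr)
    assume "b \<noteq> 0"
    moreover have "u \<in> choice_set k f" "u \<noteq> 0" using u(1) sub b(1) \<open>b \<noteq> 0\<close> by auto
    then obtain j c where "j < k" "c \<in> f j" "u = glue j c"
      unfolding choice_set_def by blast
    moreover have "c \<le> 7" using sub7 calculation by fastforce
    ultimately show False using glue_eq_iff[of b c k j] cube_le_7 b by simp
  qed
  then have 0: "0 \<in> T" using u(1) b(1) by simp
  have "f i = {a \<in> {1..7}. glue i a \<in> T}" if i: "i < k" for i
  proof (rule sym, rule card_seteq)
    show "finite (f i)" using sub7[OF i] finite_subset by blast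
    show "{a \<in> {1..7}. glue i a \<in> T} \<subseteq> f i"
      using glue_in_choice_set[OF i, of _ f] sub7 sub by blast
    show "card (f i) \<le> card {a \<in> {1..7}. glue i a \<in> T}"
      using card_local_part_ge_3[OF T 0 i] local_sets_props(2) f[OF i] by simp
  qed
  then have "choice_set k f \<subseteq> T" using 0 by (auto simp: choice_set_def)
  with sub show False by blast
qed

section \<open>Counting and the growth rate\<close>

lemma card_minimal_bouquet:
  assumes "0 < r"
  shows "15 ^ k \<le> card {S. minimal_connected_dominating_set (bouquet_graph k r) S}"
proof -
  \<comment> \<open>Extensional functions make each family of choices a single function, so there
    are exactly \<open>15 ^ k\<close> of them.\<close>
  let ?F = "{..<k} \<rightarrow>\<^sub>E local_sets"
  have sub7: "f i \<subseteq> {1..7}" if "f \<in> ?F" "i < k" for f i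
    using local_sets_props(1)[of "f i"] that by (auto simp: PiE_def Pi_def)
  have "inj_on (choice_set k) ?F"
  proof (rule inj_onI)
    fix f g
    assume fg: "f \<in> ?F" "g \<in> ?F" "choice_set k f = choice_set k g"
    have "f i = g i" if i: "i < k" for i
      using glue_in_choice_set[OF i, of _ f] glue_in_choice_set[OF i, of _ g] fg(3)
        sub7[OF fg(1)] sub7[OF fg(2)] i by blast
    then show "f = g" using fg(1,2) by (intro PiE_ext) auto
  qed
  then have "card (choice_set k ` ?F) = card ?F" by (rule card_image)
  also have "\<dots> = 15 ^ k" by (simp add: card_PiE card_local_sets)
  finally have "15 ^ k = card (choice_set k ` ?F)" ..
  also have "\<dots> \<le> card {S. minimal_connected_dominating_set (bouquet_graph k r) S}"
  proof (rule card_mono)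
    show "finite {S. minimal_connected_dominating_set (bouquet_graph k r) S}"
      using finite_minimal_connected_dominating_sets(1)[OF pair_graph_bouquet] .
    show "choice_set k ` ?F \<subseteq> {S. minimal_connected_dominating_set (bouquet_graph k r) S}"
      using minimal_choice_set assms by (auto simp: PiE_def Pi_def)
  qed
  finally show ?thesis .
qed

lemma admissible_bouquet: "admissible (7 * k + r + 1) (bouquet_graph k r)"
proof -
  have sub: "parcs (bouquet_graph k r) \<subseteq> bouquet" by auto
  show ?thesis
    unfolding admissible_def
    using pair_graph_bouquet card_bouquet_verts degenerate_subbouquet[OF sub]
      bipartite_subbouquet[OF sub] planar_subbouquet[OF sub] by simp
qed

lemma P_lower:
  assumes "2 \<le> n"
  shows "15 ^ ((n - 2) div 7) \<le> P n"
proof -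
  \<comment> \<open>Two vertices are set aside for the hub and the one leaf that must exist; the
    remainder modulo 7 is used up by further leaves, so \<open>r\<close> ranges from 1 to 7.\<close>
  define k r where "k = (n - 2) div 7" and "r = (n - 2) mod 7 + 1"
  have "7 * k + r + 1 = n" using assms unfolding k_def r_def by simp
  then have "admissible n (bouquet_graph k r)" using admissible_bouquet[of k r] by simp
  then have "card {S. minimal_connected_dominating_set (bouquet_graph k r) S} \<le> P n"
    by (rule P_upper)
  moreover have "0 < r" by (simp add: r_def)
  ultimately show ?thesis
    using card_minimal_bouquet[of r k] unfolding k_def by linarith
qed

theorem corollary1:
  shows "(\<lambda>n. real (P n)) \<in> \<Omega>(\<lambda>n. (1.472 :: real) ^ n)"
proof (rule landau_omega.bigI[of "1 / 1.472 ^ 8"])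
  show "\<forall>\<^sub>F n in sequentially. 1 / 1.472 ^ 8 * norm ((1.472 :: real) ^ n) \<le> norm (real (P n))"
  proof (rule eventually_sequentiallyI)
    fix n :: nat
    assume n: "2 \<le> n"
    define k where "k = (n - 2) div 7"
    \<comment> \<open>Two vertices are set aside and the division drops at most six more, which
      explains the constant \<open>1 / 1.472 ^ 8\<close>.\<close>
    have "n \<le> 7 * k + 8" using n unfolding k_def by presburger
    then have "(1.472 :: real) ^ n \<le> 1.472 ^ (7 * k + 8)" by (intro power_increasing) auto
    also have "\<dots> = (1.472 ^ 7) ^ k * 1.472 ^ 8" by (simp add: power_add power_mult)
    also have "\<dots> \<le> 15 ^ k * 1.472 ^ 8"
      \<comment> \<open>The numerical margin is small: \<open>1.472 ^ 7\<close> is about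
        14.97.\<close>
      by (intro mult_right_mono power_mono) (auto simp: power_divide)
    also have "15 ^ k \<le> real (P n)"
      using P_lower[OF n] unfolding k_def by (metis of_nat_le_iff of_nat_numeral of_nat_power)
    finally have "(1.472 :: real) ^ n \<le> real (P n) * 1.472 ^ 8" by simp
    then show "1 / 1.472 ^ 8 * norm ((1.472 :: real) ^ n) \<le> norm (real (P n))"
      by (simp add: field_simps)
  qed
qed simp

end
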